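(* Let $\eta>0$, $x_0\in\mathbb{R}$, and let $\mathcal{P}_0\subset\mathbb{R}^2$ be a nonempty bounded convex polytope with $b\neq0$ for all $[a,b]^T\in\mathcal{P}_0$. If $\lambda(\mathcal{P}_0)<1$, then the problem $$V_{RSF}(x_0,\mathcal{P}_0)=\min_{k\in\mathbb{R}}Q^{1:\infty}(x_0,\mathcal{P}_0,u_{0:\infty})\quad\text{s.t. } u_n=kx_n\ \ \forall n$$ attains its optimum with the controller $u^{RSF}_n=K(\mathcal{P}_0)x_n$, and $$V_{RSF}(x_0,\mathcal{P}_0)=\big(\lambda(\mathcal{P}_0)|x_0|+\eta\big)\vee\left(\frac{\eta}{1-\lambda(\mathcal{P}_0)}\right).$$ Conversely, if $\lambda(\mathcal{P}_0)\ge1$, then for any choice of $k$ the cost $Q^{1:\infty}(x_0,\mathcal{P}_0,u_{0:\infty})$ with $u_n=kx_n$ is infinite, so that $V_{RSF}(x_0,\mathcal{P}_0)=\infty$.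
   Context: Notation: $a\vee b:=\max\{a,b\}$. The stability margin and the gain of a parameter set $\mathcal{P}$ are $$\lambda(\mathcal{P}):=\min_{k\in\mathbb{R}}\max_{[a,b]^T\in\mathcal{P}}|a+bk|,\qquad K(\mathcal{P}):=\operatorname{argmin}_{k}\max_{[a,b]^T\in\mathcal{P}}|a+bk|.$$ For causal controllers $u_n=u_n(x_0,\dots,x_n)$, the worst-case cost is $$Q^{1:\infty}(x_0,\mathcal{P}_0,u_{0:\infty}):=\max_{[a,b]^T\in\mathcal{P}_0}\ \max_{\|w_{0:\infty}\|_\infty\le\eta}\ \sup_{n\ge1}|x_n|\quad\text{s.t. } x_{n+1}=ax_n+bu_n+w_n,$$ where the maxima are read as suprema in $[0,\infty]$. *)

theory Defs
  imports "HOL-Analysis.Analysis"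
begin

text \<open>A parameter set is a set of pairs \<open>(a, b)\<close>. The maximum and the minimum below are
  written as \<open>Sup\<close> and \<open>Inf\<close>; for the parameter sets considered (nonempty, compact,
  \<open>b \<noteq> 0\<close> throughout) they are attained, and the minimizer is unique: see
  \<open>worst_gain_attained\<close> and \<open>ex1_arg_min_worst_gain\<close>.\<close>

definition worst_gain :: "(real \<times> real) set \<Rightarrow> real \<Rightarrow> real" where
  "worst_gain P k = (SUP (a, b)\<in>P. \<bar>a + b * k\<bar>)"

definition stability_margin :: "(real \<times> real) set \<Rightarrow> real" where
  "stability_margin P = (INF k. worst_gain P k)"

definition gain :: "(real \<times> real) set \<Rightarrow> real" where
  "gain P = arg_min (worst_gain P) (\<lambda>_. True)"

text \<open>A causal controller maps the time \<open>n\<close> and the list \<open>[x 0, \<dots>, x n]\<close> to the input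
  at time \<open>n\<close>.\<close>

type_synonym controller = "nat \<Rightarrow> real list \<Rightarrow> real"

definition closed_loop ::
  "real \<Rightarrow> real \<Rightarrow> controller \<Rightarrow> (nat \<Rightarrow> real) \<Rightarrow> real \<Rightarrow> (nat \<Rightarrow> real) \<Rightarrow> bool" where
  "closed_loop a b u w x0 x \<longleftrightarrow>
     x 0 = x0 \<and> (\<forall>n. x (Suc n) = a * x n + b * u n (map x [0..<Suc n]) + w n)"

text \<open>The disturbance \<open>w\<close> determines the trajectory \<open>x\<close>, so the inner supremum over pairs
  \<open>(w, x)\<close> is the supremum over \<open>w\<close>.\<close>

definition worst_case_cost ::
  "real \<Rightarrow> real \<Rightarrow> (real \<times> real) set \<Rightarrow> controller \<Rightarrow> ennreal" where
  "worst_case_cost \<eta> x0 P u =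
     (SUP (a, b)\<in>P. SUP (w, x)\<in>{(w, x). (\<forall>n. \<bar>w n\<bar> \<le> \<eta>) \<and> closed_loop a b u w x0 x}.
        SUP n\<in>{1..}. ennreal \<bar>x n\<bar>)"

definition static_feedback :: "real \<Rightarrow> controller" where
  "static_feedback k n xs = k * last xs"

definition V_RSF :: "real \<Rightarrow> real \<Rightarrow> (real \<times> real) set \<Rightarrow> ennreal" where
  "V_RSF \<eta> x0 P = (INF k. worst_case_cost \<eta> x0 P (static_feedback k))"

lemma closed_loop_ex1: "\<exists>!x. closed_loop a b u w x0 x"
proof -
  define h where "h = rec_nat [x0] (\<lambda>n xs. xs @ [a * last xs + b * u n xs + w n])"
  have h0: "h 0 = [x0]"
    and hS: "\<And>n. h (Suc n) = h n @ [a * last (h n) + b * u n (h n) + w n]"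
    by (simp_all add: h_def)
  have hm: "h n = map (\<lambda>i. last (h i)) [0..<Suc n]" for n
    by (induction n) (simp_all add: h0 hS)
  have "closed_loop a b u w x0 (\<lambda>i. last (h i))"
    unfolding closed_loop_def hm[symmetric] by (simp add: h0 hS)
  moreover have "x = y" if x: "closed_loop a b u w x0 x" and y: "closed_loop a b u w x0 y" for x y
  proof
    fix n show "x n = y n"
    proof (induction n rule: less_induct)
      case (less n)
      show ?case
      proof (cases n)
        case 0 then show ?thesis using x y by (simp add: closed_loop_def)
      next
        case (Suc m)
        have "map x [0..<Suc m] = map y [0..<Suc m]" "x m = y m"
          using less Suc by auto
        then show ?thesis using x y Suc unfolding closed_loop_def by metis
      qed
    qed
  qed
  ultimately show ?thesis by blast
qed

lemma worst_gain_attained: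
  assumes "compact P" "P \<noteq> {}"
  shows "\<exists>(a, b)\<in>P. worst_gain P k = \<bar>a + b * k\<bar> \<and> (\<forall>(a', b')\<in>P. \<bar>a' + b' * k\<bar> \<le> \<bar>a + b * k\<bar>)"
proof -
  have "continuous_on P (\<lambda>p. \<bar>fst p + snd p * k\<bar>)"
    by (intro continuous_intros)
  from continuous_attains_sup[OF assms this]
  obtain p where p: "p \<in> P" "\<And>q. q \<in> P \<Longrightarrow> \<bar>fst q + snd q * k\<bar> \<le> \<bar>fst p + snd p * k\<bar>"
    by blast
  have "worst_gain P k = \<bar>fst p + snd p * k\<bar>"
    unfolding worst_gain_def case_prod_beta using p by (intro cSup_eq_maximum) auto
  then show ?thesis using p by (intro bexI[of _ p]) (auto simp: case_prod_beta)
qed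

lemma worst_gain_ge:
  assumes "compact P" "(a, b) \<in> P"
  shows "\<bar>a + b * k\<bar> \<le> worst_gain P k"
  using worst_gain_attained[of P k] assms by fastforce

lemma ex1_arg_min_worst_gain:
  assumes P: "compact P" "P \<noteq> {}" and b: "\<And>a b. (a, b) \<in> P \<Longrightarrow> b \<noteq> 0"
  shows "\<exists>!k. is_arg_min (worst_gain P) (\<lambda>_. True) k"
proof -
  obtain B where B: "\<And>p. p \<in> P \<Longrightarrow> norm p \<le> B" and B0: "B > 0"
    using P(1) compact_imp_bounded bounded_pos by metis
  have Bs: "\<bar>b\<bar> \<le> B" if "(a, b) \<in> P" for a b
    using B[OF that] norm_snd_le[of b a] by simp
  have lip: "worst_gain P k \<le> worst_gain P l + B * \<bar>k - l\<bar>" for k l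
  proof -
    obtain a b where ab: "(a, b) \<in> P" "worst_gain P k = \<bar>a + b * k\<bar>"
      using worst_gain_attained[OF P, of k] by blast
    have "\<bar>a + b * k\<bar> = \<bar>(a + b * l) + b * (k - l)\<bar>" by (simp add: algebra_simps)
    also have "\<dots> \<le> \<bar>a + b * l\<bar> + \<bar>b\<bar> * \<bar>k - l\<bar>"
      using abs_triangle_ineq[of "a + b * l" "b * (k - l)"] by (simp add: abs_mult)
    also have "\<dots> \<le> worst_gain P l + B * \<bar>k - l\<bar>"
      using worst_gain_ge[OF P(1) ab(1), of l] Bs[OF ab(1)] by (intro add_mono mult_right_mono) auto
    finally show ?thesis using ab by simp
  qed
  have cont: "continuous_on S (worst_gain P)" for S
  proof (rule lipschitz_on_continuous_on[of B], rule lipschitz_onI)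
    fix k l
    show "dist (worst_gain P k) (worst_gain P l) \<le> B * dist k l"
      using lip[of k l] lip[of l k] by (simp add: dist_real_def abs_le_iff abs_minus_commute)
  qed (use B0 in simp)
  obtain a0 b0 where ab0: "(a0, b0) \<in> P" using P(2) by auto
  define R where "R = (worst_gain P 0 + \<bar>a0\<bar>) / \<bar>b0\<bar>"
  have w0: "worst_gain P 0 \<ge> 0" using worst_gain_ge[OF P(1) ab0, of 0] by linarith
  have b0: "\<bar>b0\<bar> > 0" using b[OF ab0] by simp
  have R: "R \<ge> 0" using w0 b0 by (simp add: R_def)
  have "\<exists>k\<in>{-R..R}. \<forall>l\<in>{-R..R}. worst_gain P k \<le> worst_gain P l"
    using R by (intro continuous_attains_inf cont) auto
  then obtain k where k: "\<And>l. l \<in> {-R..R} \<Longrightarrow> worst_gain P k \<le> worst_gain P l"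
    by blast
  have kmin: "worst_gain P k \<le> worst_gain P l" for l
  proof (cases "\<bar>l\<bar> \<le> R")
    case True then show ?thesis using k[of l] by (simp add: abs_le_iff)
  next
    case False
    then have "worst_gain P 0 + \<bar>a0\<bar> < \<bar>b0\<bar> * \<bar>l\<bar>"
      using b0 by (simp add: R_def field_simps)
    also have "\<dots> = \<bar>(a0 + b0 * l) - a0\<bar>" by (simp add: abs_mult)
    also have "\<dots> \<le> \<bar>a0 + b0 * l\<bar> + \<bar>a0\<bar>" by linarith
    finally have "worst_gain P 0 < worst_gain P l"
      using worst_gain_ge[OF P(1) ab0, of l] by linarith
    then show ?thesis using k[of 0] R by simp
  qed
  have "l = k" if l: "\<And>m. worst_gain P l \<le> worst_gain P m" for l
  proof (rule ccontr)
    assume ne: "l \<noteq> k"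
    obtain a b' where ab: "(a, b') \<in> P" "worst_gain P ((k + l) / 2) = \<bar>a + b' * ((k + l) / 2)\<bar>"
      using worst_gain_attained[OF P, of "(k + l) / 2"] by blast
    define s t where "s = a + b' * k" and "t = a + b' * l"
    have st: "a + b' * ((k + l) / 2) = (s + t) / 2" by (simp add: s_def t_def field_simps)
    have "s - t = b' * (k - l)" by (simp add: s_def t_def algebra_simps)
    then have "s \<noteq> t" using ne b[OF ab(1)] by auto
    have "worst_gain P k = worst_gain P l"
      using kmin[of l] l[of k] by (rule antisym)
    moreover have "\<bar>s\<bar> \<le> worst_gain P k" "\<bar>t\<bar> \<le> worst_gain P l"
      using worst_gain_ge[OF P(1) ab(1)] by (simp_all add: s_def t_def)
    moreover have "worst_gain P k \<le> \<bar>(s + t) / 2\<bar>"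
      using kmin[of "(k + l) / 2"] ab(2) st by simp
    ultimately have "s \<le> t" "t \<le> s" by (auto simp: abs_if field_simps split: if_splits)
    then have "s = t" by (rule antisym)
    with \<open>s \<noteq> t\<close> show False ..
  qed
  then show ?thesis
    using kmin by (intro ex1I[of _ k]) (auto simp: is_arg_min_def not_less)
qed

end

theory Submission
  imports Defs
begin

text \<open>Under \<open>u n = k * x n\<close> a plant \<open>(a, b)\<close> evolves by \<open>x (Suc n) = c * x n + w n\<close> with
  \<open>c = a + b * k\<close>. The most harmful disturbance has size \<open>\<eta>\<close> and the sign of \<open>c * x n\<close>; it turns
  the triangle inequality into the equation \<open>\<bar>x (Suc n)\<bar> = \<bar>c\<bar> * \<bar>x n\<bar> + \<eta>\<close>. This recursion is
  increasing in \<open>\<bar>c\<bar>\<close>, so the worst plant is one with \<open>\<bar>c\<bar> = worst_gain P k\<close>, which exists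
  because \<open>P\<close> is compact. Hence the cost depends on \<open>k\<close> only through \<open>g = worst_gain P k\<close>.

  If \<open>g < 1\<close>, the recursion moves monotonically from \<open>\<bar>x0\<bar>\<close> towards its fixed point
  \<open>\<eta> / (1 - g)\<close>, so its supremum over \<open>n \<ge> 1\<close> is the larger of its first value \<open>g * \<bar>x0\<bar> + \<eta>\<close>
  and its limit. If \<open>g \<ge> 1\<close>, every step adds at least \<open>\<eta>\<close> and the cost is infinite. This is
  \<open>worst_case_cost_static_feedback\<close>. The cost increases with \<open>g\<close>, so minimizing it over \<open>k\<close>
  amounts to minimizing \<open>worst_gain P k\<close>, which \<open>gain P\<close> does, with minimum
  \<open>stability_margin P\<close>.\<close>

lemma closed_loop_static_feedback:
  "closed_loop a b (static_feedback k) w x0 x \<longleftrightarrow>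
     x 0 = x0 \<and> (\<forall>n. x (Suc n) = (a + b * k) * x n + w n)"
  by (simp add: closed_loop_def static_feedback_def algebra_simps)

fun peak :: "real \<Rightarrow> real \<Rightarrow> real \<Rightarrow> nat \<Rightarrow> real" where
  "peak \<eta> g r 0 = r"
| "peak \<eta> g r (Suc n) = g * peak \<eta> g r n + \<eta>"

text \<open>A disturbance that always pushes the state away from the origin attains equality in
  \<open>\<bar>x (Suc n)\<bar> \<le> \<bar>c\<bar> * \<bar>x n\<bar> + \<eta>\<close>.\<close>

lemma adversarial_disturbance:
  assumes "\<eta> \<ge> 0"
  obtains w x where "\<forall>n. \<bar>w n\<bar> \<le> \<eta>" "closed_loop a b (static_feedback k) w x0 x"
    and "\<And>n. \<bar>x n\<bar> = peak \<eta> \<bar>a + b * k\<bar> \<bar>x0\<bar> n"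
proof -
  define c where "c = a + b * k"
  \<comment> \<open>At \<open>y = 0\<close> the push must not vanish, which rules out \<open>sgn\<close>.\<close>
  define push where "push y = (if y \<ge> 0 then \<eta> else - \<eta>)" for y :: real
  define x where "x = rec_nat x0 (\<lambda>_ y. c * y + push (c * y))"
  have x0: "x 0 = x0" and xS: "\<And>n. x (Suc n) = c * x n + push (c * x n)"
    by (simp_all add: x_def)
  have "\<bar>y + push y\<bar> = \<bar>y\<bar> + \<eta>" for y
    using assms by (simp add: push_def)
  then have "\<bar>x n\<bar> = peak \<eta> \<bar>c\<bar> \<bar>x0\<bar> n" for n
    by (induction n) (simp_all add: x0 xS abs_mult)
  moreover have "closed_loop a b (static_feedback k) (\<lambda>n. push (c * x n)) x0 x"
    by (simp add: closed_loop_static_feedback x0 xS c_def)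
  moreover have "\<forall>n. \<bar>push (c * x n)\<bar> \<le> \<eta>"
    using assms by (simp add: push_def)
  ultimately show thesis
    using that by (simp add: c_def)
qed

lemma peak_tendsto:
  assumes "0 \<le> g" "g < 1"
  shows "peak \<eta> g r \<longlonglongrightarrow> \<eta> / (1 - g)"
proof -
  define L where "L = \<eta> / (1 - g)"
  have "L * (1 - g) = \<eta>"
    using assms by (simp add: L_def)
  then have fixpoint: "\<eta> = L - g * L"
    by (simp add: algebra_simps)
  have "peak \<eta> g r = (\<lambda>n. L + g ^ n * (r - L))"
  proof
    fix n
    show "peak \<eta> g r n = L + g ^ n * (r - L)"
    proof (induction n)
      case (Suc n)
      have "peak \<eta> g r (Suc n) = g * (L + g ^ n * (r - L)) + \<eta>"
        by (simp add: Suc)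
      then show ?case
        by (simp add: fixpoint algebra_simps)
    qed simp
  qed
  moreover have "(\<lambda>n. L + g ^ n * (r - L)) \<longlonglongrightarrow> L + 0 * (r - L)"
    using assms by (intro tendsto_intros LIMSEQ_power_zero) simp
  ultimately show ?thesis
    by (simp add: L_def)
qed

lemma peak_ge_linear:
  assumes "\<eta> \<ge> 0" "g \<ge> 1" "r \<ge> 0"
  shows "peak \<eta> g r n \<ge> real n * \<eta>"
proof (induction n)
  case (Suc n)
  then have "peak \<eta> g r n \<ge> 0"
    using assms by (meson mult_nonneg_nonneg of_nat_0_le_iff order_trans)
  then have "peak \<eta> g r n \<le> g * peak \<eta> g r n"
    using assms by (simp add: mult_le_cancel_right1)
  then show ?case
    using Suc by (simp add: algebra_simps)
qed (use assms in simp)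

text \<open>The bound is invariant from time 1 on: a level \<open>M \<ge> \<eta> / (1 - g)\<close> satisfies
  \<open>g * M + \<eta> \<le> M\<close>. It can fail at time 0, where \<open>\<bar>x0\<bar>\<close> is arbitrary.\<close>

lemma closed_loop_bound:
  assumes loop: "closed_loop a b (static_feedback k) w x0 x"
    and w: "\<And>n. \<bar>w n\<bar> \<le> \<eta>" and g: "\<bar>a + b * k\<bar> \<le> g" "g < 1"
  shows "\<bar>x (Suc n)\<bar> \<le> max (g * \<bar>x0\<bar> + \<eta>) (\<eta> / (1 - g))"
proof -
  define M where "M = max (g * \<bar>x0\<bar> + \<eta>) (\<eta> / (1 - g))"
  have step: "\<bar>x (Suc n)\<bar> \<le> g * \<bar>x n\<bar> + \<eta>" for n
  proof -
    have "\<bar>x (Suc n)\<bar> \<le> \<bar>a + b * k\<bar> * \<bar>x n\<bar> + \<bar>w n\<bar>"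
      using loop abs_triangle_ineq[of "(a + b * k) * x n" "w n"]
      by (simp add: closed_loop_static_feedback abs_mult)
    also have "\<dots> \<le> g * \<bar>x n\<bar> + \<eta>"
      using g w by (intro add_mono mult_right_mono) auto
    finally show ?thesis .
  qed
  have "\<eta> / (1 - g) \<le> M"
    by (simp add: M_def)
  then have inv: "g * M + \<eta> \<le> M"
    using g by (simp add: field_simps)
  have "\<bar>x (Suc n)\<bar> \<le> M"
  proof (induction n)
    case 0
    show ?case
      using step[of 0] loop by (simp add: closed_loop_static_feedback M_def)
  next
    case (Suc n)
    have "g * \<bar>x (Suc n)\<bar> \<le> g * M"
      using Suc g by (intro mult_left_mono) auto
    then show ?case
      using step[of "Suc n"] inv by linarith
  qed
  then show ?thesis
    by (simp add: M_def)
qed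

lemma worst_case_cost_ge_peak:
  assumes "\<eta> \<ge> 0" "compact P" "P \<noteq> {}" "n \<ge> 1"
  shows "ennreal (peak \<eta> (worst_gain P k) \<bar>x0\<bar> n) \<le> worst_case_cost \<eta> x0 P (static_feedback k)"
proof -
  obtain a b where ab: "(a, b) \<in> P" "worst_gain P k = \<bar>a + b * k\<bar>"
    using worst_gain_attained[OF assms(2,3), of k] by blast
  obtain w x where w: "\<forall>n. \<bar>w n\<bar> \<le> \<eta>" and loop: "closed_loop a b (static_feedback k) w x0 x"
    and x: "\<And>n. \<bar>x n\<bar> = peak \<eta> \<bar>a + b * k\<bar> \<bar>x0\<bar> n"
    using adversarial_disturbance[OF assms(1)] by metis
  have "ennreal \<bar>x n\<bar> \<le> worst_case_cost \<eta> x0 P (static_feedback k)"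
    unfolding worst_case_cost_def
    by (rule SUP_upper2[OF ab(1)], simp, rule SUP_upper2[of "(w, x)"])
      (use w loop assms(4) in \<open>auto intro: SUP_upper\<close>)
  then show ?thesis
    by (simp add: x ab(2))
qed

text \<open>The lower bound comes from one adversarial trajectory of a plant with the worst gain: its
  value at time 1 is the first argument of the maximum and its limit is the second. The limit may
  not be reached at any time, but a supremum is at least every limit.\<close>

lemma worst_case_cost_static_feedback:
  fixes k :: real
  assumes eta: "\<eta> > 0" and P: "compact P" "P \<noteq> {}"
  defines "g \<equiv> worst_gain P k"
  shows "worst_case_cost \<eta> x0 P (static_feedback k) =
    (if g < 1 then ennreal (max (g * \<bar>x0\<bar> + \<eta>) (\<eta> / (1 - g))) else \<infinity>)"
    (is "?cost = _")
proof -
  have ge_peak: "ennreal (peak \<eta> g \<bar>x0\<bar> n) \<le> ?cost" if "n \<ge> 1" for n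
    unfolding g_def using eta P that by (intro worst_case_cost_ge_peak) auto
  show ?thesis
  proof (cases "g < 1")
    case True
    have g0: "0 \<le> g"
      using worst_gain_attained[OF P, of k] by (auto simp: g_def)
    have "?cost \<le> ennreal (max (g * \<bar>x0\<bar> + \<eta>) (\<eta> / (1 - g)))"
      unfolding worst_case_cost_def
    proof (clarsimp intro!: SUP_least simp del: max.bounded_iff)
      fix a b w x and n :: nat
      assume *: "(a, b) \<in> P" "\<forall>n. \<bar>w n\<bar> \<le> \<eta>" "closed_loop a b (static_feedback k) w x0 x"
        and "Suc 0 \<le> n"
      then obtain m where "n = Suc m"
        by (cases n) auto
      then show "ennreal \<bar>x n\<bar> \<le> ennreal (max (g * \<bar>x0\<bar> + \<eta>) (\<eta> / (1 - g)))"
        using * True worst_gain_ge[OF P(1) *(1), of k]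
        by (auto intro!: ennreal_leI closed_loop_bound simp: g_def)
    qed
    moreover have "ennreal (g * \<bar>x0\<bar> + \<eta>) \<le> ?cost"
      using ge_peak[of 1] by simp
    moreover have "ennreal (\<eta> / (1 - g)) \<le> ?cost"
    proof (rule LIMSEQ_le_const2)
      show "(\<lambda>n. ennreal (peak \<eta> g \<bar>x0\<bar> n)) \<longlonglongrightarrow> ennreal (\<eta> / (1 - g))"
        by (intro tendsto_ennrealI peak_tendsto g0 True)
      show "\<exists>N. \<forall>n\<ge>N. ennreal (peak \<eta> g \<bar>x0\<bar> n) \<le> ?cost"
        using ge_peak by blast
    qed
    ultimately show ?thesis
      using True by (auto simp: max_def intro: antisym)
  next
    case False
    have "?cost = \<infinity>"
    proof (rule ccontr)
      assume "?cost \<noteq> \<infinity>"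
      then obtain C where C: "?cost = ennreal C" "C \<ge> 0"
        by (cases ?cost) auto
      obtain n :: nat where n: "C / \<eta> < real n"
        using reals_Archimedean2 by blast
      then have "n \<ge> 1"
        using C(2) eta by (cases n) (auto simp: divide_less_0_iff)
      then have "peak \<eta> g \<bar>x0\<bar> n \<le> C"
        using ge_peak[of n] C by simp
      moreover have "real n * \<eta> \<le> peak \<eta> g \<bar>x0\<bar> n"
        using eta False by (intro peak_ge_linear) auto
      moreover have "C < real n * \<eta>"
        using n eta by (simp add: field_simps)
      ultimately show False
        by linarith
    qed
    then show ?thesis
      using False by simp
  qed
qed

lemma worst_case_cost_static_feedback_mono:
  assumes eta: "\<eta> > 0" and P: "compact P" "P \<noteq> {}" and kl: "worst_gain P k \<le> worst_gain P l"
  shows "worst_case_cost \<eta> x0 P (static_feedback k) \<le> worst_case_cost \<eta> x0 P (static_feedback l)"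
proof (cases "worst_gain P l < 1")
  case True
  have "\<eta> / (1 - worst_gain P k) \<le> \<eta> / (1 - worst_gain P l)"
    using eta kl True by (intro divide_left_mono) auto
  moreover have "worst_gain P k * \<bar>x0\<bar> + \<eta> \<le> worst_gain P l * \<bar>x0\<bar> + \<eta>"
    using kl by (simp add: mult_right_mono)
  ultimately show ?thesis
    using kl True by (simp only: worst_case_cost_static_feedback[OF eta P] if_True order.strict_trans1)
      (intro ennreal_leI max.mono)
qed (simp add: worst_case_cost_static_feedback[OF eta P])

lemma gain_minimizes_worst_gain:
  assumes "compact P" "P \<noteq> {}" "\<And>a b. (a, b) \<in> P \<Longrightarrow> b \<noteq> 0"
  shows "worst_gain P (gain P) \<le> worst_gain P k"
proof -
  have "\<exists>k. is_arg_min (worst_gain P) (\<lambda>_. True) k"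
    by (intro ex1_implies_ex ex1_arg_min_worst_gain) (use assms in auto)
  then have "is_arg_min (worst_gain P) (\<lambda>_. True) (gain P)"
    unfolding gain_def arg_min_def by (rule someI_ex)
  then show ?thesis
    by (simp add: is_arg_min_linorder)
qed

lemma stability_margin_eq_worst_gain_gain:
  assumes "compact P" "P \<noteq> {}" "\<And>a b. (a, b) \<in> P \<Longrightarrow> b \<noteq> 0"
  shows "stability_margin P = worst_gain P (gain P)"
  unfolding stability_margin_def
  by (intro cInf_eq_minimum) (use gain_minimizes_worst_gain[of P] assms in auto)

theorem mainTheorem4:
  fixes \<eta> x0 :: real and P0 :: "(real \<times> real) set"
  assumes "\<eta> > 0"
    and "polytope P0" and "P0 \<noteq> {}"
    and "\<And>a b. (a, b) \<in> P0 \<Longrightarrow> b \<noteq> 0"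
  shows "(stability_margin P0 < 1 \<longrightarrow>
            is_arg_min (\<lambda>k. worst_case_cost \<eta> x0 P0 (static_feedback k)) (\<lambda>_. True) (gain P0) \<and>
            V_RSF \<eta> x0 P0 = worst_case_cost \<eta> x0 P0 (static_feedback (gain P0)) \<and>
            V_RSF \<eta> x0 P0 =
              ennreal (max (stability_margin P0 * \<bar>x0\<bar> + \<eta>) (\<eta> / (1 - stability_margin P0)))) \<and>
         (stability_margin P0 \<ge> 1 \<longrightarrow>
            (\<forall>k. worst_case_cost \<eta> x0 P0 (static_feedback k) = \<infinity>) \<and>
            V_RSF \<eta> x0 P0 = \<infinity>)"
proof -
  have P: "compact P0" "P0 \<noteq> {}"
    using assms by (auto intro: polytope_imp_compact)
  note cost = worst_case_cost_static_feedback[OF assms(1) P]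
  have margin: "stability_margin P0 = worst_gain P0 (gain P0)"
    using P assms(4) by (rule stability_margin_eq_worst_gain_gain)
  have gain_min: "worst_gain P0 (gain P0) \<le> worst_gain P0 k" for k
    using P assms(4) by (rule gain_minimizes_worst_gain)
  have opt: "worst_case_cost \<eta> x0 P0 (static_feedback (gain P0))
      \<le> worst_case_cost \<eta> x0 P0 (static_feedback k)" for k
    by (intro worst_case_cost_static_feedback_mono assms(1) P gain_min)
  have V: "V_RSF \<eta> x0 P0 = worst_case_cost \<eta> x0 P0 (static_feedback (gain P0))"
    unfolding V_RSF_def by (intro antisym INF_lower INF_greatest opt UNIV_I)
  show ?thesis
  proof (intro conjI impI allI)
    show "is_arg_min (\<lambda>k. worst_case_cost \<eta> x0 P0 (static_feedback k)) (\<lambda>_. True) (gain P0)"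
      by (simp add: is_arg_min_linorder opt)
  next
    assume "stability_margin P0 < 1"
    then show "V_RSF \<eta> x0 P0 =
        ennreal (max (stability_margin P0 * \<bar>x0\<bar> + \<eta>) (\<eta> / (1 - stability_margin P0)))"
      by (simp add: V cost margin)
  next
    fix k
    assume "stability_margin P0 \<ge> 1"
    then have "worst_gain P0 k \<ge> 1" for k
      using gain_min[of k] by (simp add: margin)
    then have inf: "worst_case_cost \<eta> x0 P0 (static_feedback k) = \<infinity>" for k
      by (simp add: cost not_less)
    then show "worst_case_cost \<eta> x0 P0 (static_feedback k) = \<infinity>" .
    from inf show "V_RSF \<eta> x0 P0 = \<infinity>"
      by (simp add: V)
  qed (rule V)
qed

end
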